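(* For each integer $n\ge 1$ let $\rho_6(n)$ denote the number of partitions of $n$ in which the largest part $\ell$ appears exactly once, each remaining part is congruent to $1$ or $5$ modulo $6$ (repetitions allowed), and the remaining parts (all strictly smaller than $\ell$) form a partition of $\ell$ (no congruence condition is imposed on $\ell$). Then for every $n\ge1$, $\rho_6(n)$ equals the coefficient of $q^n$ in $$\frac{1}{(q^2,q^{10};q^{12})_{\infty}}-\frac{q^2+q^{10}}{1-q^{12}}.$$
   Context: A partition of a positive integer $n$ is a way of writing $n$ as a sum of positive integers (parts), listed in non-increasing order. For $|q|<1$, $(t;q)_0=1$, $(t;q)_n=(1-t)(1-tq)\cdots(1-tq^{n-1})$ for $n>0$, $(t;q)_\infty=\lim_{n\to\infty}(t;q)_n$, and $(a,b;q)_\infty=(a;q)_\infty(b;q)_\infty$. *)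

theory Defs
  imports "HOL-Analysis.Analysis" "HOL-Library.Multiset"
begin

text \<open>Partitions are multisets of positive integers, a multiset being the same datum as its
  non-increasing listing.\<close>

definition partitions_of :: "nat \<Rightarrow> nat multiset set" where
  "partitions_of n = {P. (\<forall>p\<in>#P. p > 0) \<and> sum_mset P = n}"

lemma finite_partitions_of: "finite (partitions_of n)"
proof -
  have "P \<in> mset ` {xs. set xs \<subseteq> {..n} \<and> length xs \<le> n}" if "P \<in> partitions_of n" for P
  proof -
    obtain xs where xs: "P = mset xs" by (metis ex_mset)
    with that have pos: "\<forall>p\<in>set xs. p > 0" and s: "sum_list xs = n"
      by (auto simp: partitions_of_def sum_mset_sum_list)
    have "set xs \<subseteq> {..n}" using s by (auto dest: member_le_sum_list)
    moreover have "length xs \<le> sum_list xs" using pos by (induction xs) auto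
    ultimately show ?thesis using xs s by auto
  qed
  moreover have "finite {xs. set xs \<subseteq> {..n} \<and> length xs \<le> n}"
    by (intro finite_lists_length_le) auto
  ultimately show ?thesis by (meson finite_imageI finite_subset subsetI)
qed

text \<open>For \<open>n > 0\<close> every partition is nonempty, so \<open>Max\<close> is applied to a nonempty finite set.\<close>

definition rho6 :: "nat \<Rightarrow> nat" where
  "rho6 n = card {P \<in> partitions_of n.
     let l = Max (set_mset P); R = P - {#l#} in
       count P l = 1 \<and>
       (\<forall>p\<in>#R. p mod 6 = 1 \<or> p mod 6 = 5) \<and>
       R \<in> partitions_of l}"

definition qpoch :: "complex \<Rightarrow> complex \<Rightarrow> nat \<Rightarrow> complex" where
  "qpoch t q n = (\<Prod>k<n. 1 - t * q ^ k)"

definition qpoch_inf :: "complex \<Rightarrow> complex \<Rightarrow> complex" where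
  "qpoch_inf t q = lim (\<lambda>n. qpoch t q n)"

definition qpoch_inf2 :: "complex \<Rightarrow> complex \<Rightarrow> complex \<Rightarrow> complex" where
  "qpoch_inf2 a b q = qpoch_inf a q * qpoch_inf b q"

lemma convergent_qpoch:
  assumes "norm q < 1"
  shows "convergent (\<lambda>n. qpoch t q n)"
proof -
  have "summable (\<lambda>k. norm (- (t * q ^ k)))"
    using assms by (simp add: norm_mult norm_power summable_mult summable_geometric)
  then have "convergent_prod (\<lambda>k. 1 + - (t * q ^ k))"
    by (intro abs_convergent_prod_imp_convergent_prod summable_imp_abs_convergent_prod) simp
  then have "convergent (\<lambda>n. \<Prod>k\<le>n. 1 - t * q ^ k)"
    using convergent_prod_imp_convergent by force
  then have "convergent (\<lambda>n. qpoch t q (Suc n))"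
    by (simp add: qpoch_def lessThan_Suc_atMost)
  then show ?thesis by (simp add: convergent_Suc_iff)
qed

end

theory Submission
  imports Defs
begin

text \<open>Removing the largest part \<open>l\<close> leaves a partition of \<open>l\<close>, so only \<open>n = 2 * l\<close> contributes, and
  the condition that \<open>l\<close> occurs once excludes just the partition of \<open>l\<close> into the single part \<open>l\<close>,
  admissible exactly when \<open>l\<close> is congruent to 1 or 5 modulo 6. The subtracted fraction counts these
  exceptions. The infinite product is Euler's generating function, in the variable \<open>q\<^sup>2\<close>, of the
  partitions into parts congruent to 1 or 5 modulo 6.\<close>

section \<open>Partitions with parts in a prescribed set\<close>

definition partitions_in :: "nat set \<Rightarrow> nat \<Rightarrow> nat multiset set" where
  "partitions_in S n = {P \<in> partitions_of n. set_mset P \<subseteq> S}"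

lemma finite_partitions_in: "finite (partitions_in S n)"
  using finite_partitions_of by (simp add: partitions_in_def)

lemma card_partitions_in_mono: "S \<subseteq> T \<Longrightarrow> card (partitions_in S n) \<le> card (partitions_in T n)"
  by (intro card_mono finite_partitions_in) (auto simp: partitions_in_def)

lemma partitions_of_part_le: "P \<in> partitions_of n \<Longrightarrow> p \<in># P \<Longrightarrow> p \<le> n"
  by (auto simp: partitions_of_def dest!: multi_member_split)

text \<open>No part of a partition of \<open>n\<close> exceeds \<open>n\<close>, so larger elements
  of the set are irrelevant. This is what lets an infinite set of parts be replaced by a finite
  truncation.\<close>

lemma partitions_in_cong:
  assumes "S \<inter> {..n} = T \<inter> {..n}"
  shows "partitions_in S n = partitions_in T n"
  using assms partitions_of_part_le by (fastforce simp: partitions_in_def)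

lemma partitions_in_empty: "partitions_in {} n = (if n = 0 then {{#}} else {})"
  by (auto simp: partitions_in_def partitions_of_def)

text \<open>Either \<open>p\<close> does not occur, or one copy of it can be removed; after the
  removal \<open>p\<close> may still occur, so the second term keeps
  \<open>insert p S\<close>.\<close>

lemma card_partitions_in_insert:
  assumes "p > 0" "p \<notin> S"
  shows "card (partitions_in (insert p S) n) = card (partitions_in S n) +
           (if p \<le> n then card (partitions_in (insert p S) (n - p)) else 0)"
proof -
  let ?B = "if p \<le> n then add_mset p ` partitions_in (insert p S) (n - p) else {}"
  have "partitions_in (insert p S) n = partitions_in S n \<union> ?B"
  proof (intro equalityI subsetI)
    fix P assume P: "P \<in> partitions_in (insert p S) n"
    show "P \<in> partitions_in S n \<union> ?B"
    proof (cases "p \<in># P")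
      case True
      then obtain R where R: "P = add_mset p R" by (meson multi_member_split)
      with P have "p \<le> n" "R \<in> partitions_in (insert p S) (n - p)"
        by (auto simp: partitions_in_def partitions_of_def)
      with R show ?thesis by auto
    next
      case False
      with P show ?thesis by (auto simp: partitions_in_def)
    qed
  next
    fix P assume "P \<in> partitions_in S n \<union> ?B"
    then show "P \<in> partitions_in (insert p S) n"
      using assms by (auto simp: partitions_in_def partitions_of_def split: if_splits)
  qed
  moreover have "finite ?B" using finite_partitions_in by simp
  moreover have "partitions_in S n \<inter> ?B = {}"
    using assms by (auto simp: partitions_in_def)
  moreover have "card ?B = (if p \<le> n then card (partitions_in (insert p S) (n - p)) else 0)"
    by (auto intro!: card_image inj_onI)
  ultimately show ?thesis
    using card_Un_disjoint[OF finite_partitions_in, of ?B S n] by simp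
qed

section \<open>Generating functions for finite sets of parts\<close>

text \<open>Termwise form of the functional equation G = F + x^p G, with F and G the generating
  functions for \<open>S\<close> and \<open>insert p S\<close>. The type of \<open>x\<close> is
  general because the equation serves both real bounds and complex sums.\<close>

lemma card_partitions_in_insert_mult_power:
  fixes x :: "'a::comm_semiring_1"
  assumes "p > 0" "p \<notin> S"
  shows "of_nat (card (partitions_in (insert p S) n)) * x ^ n =
     of_nat (card (partitions_in S n)) * x ^ n +
     (if p \<le> n then x ^ p * (of_nat (card (partitions_in (insert p S) (n - p))) * x ^ (n - p)) else 0)"
proof (cases "p \<le> n")
  case True
  then have "x ^ n = x ^ p * x ^ (n - p)" by (simp flip: power_add)
  with True show ?thesis
    by (simp only: card_partitions_in_insert[OF assms, of n] if_True of_nat_add distrib_right distrib_left mult.left_commute)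
next
  case False
  then show ?thesis by (simp add: card_partitions_in_insert[OF assms, of n])
qed

text \<open>Supplies absolute convergence, without which the functional equation could not be solved
  for the value of the series. For nonnegative \<open>r\<close> the equation survives truncation at
  \<open>M\<close> as an inequality.\<close>

lemma sum_card_partitions_in_le:
  fixes r :: real
  assumes "finite S" "0 \<notin> S" "0 \<le> r" "r < 1"
  shows "(\<Sum>n<M. card (partitions_in S n) * r ^ n) \<le> (\<Prod>p\<in>S. 1 / (1 - r ^ p))"
  using assms(1,2)
proof (induction S rule: finite_induct)
  case empty
  have "(\<Sum>n<M. card (partitions_in {} n) * r ^ n) = (\<Sum>n<M. if n = 0 then 1 else 0)"
    by (intro sum.cong) (auto simp: partitions_in_empty)
  then show ?case by simp
next
  case (insert p S)
  define g where "g n = card (partitions_in (insert p S) n) * r ^ n" for n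
  have p: "p > 0" using insert.prems by auto
  then have rp: "r ^ p < 1" using assms by (simp add: power_less_one_iff)
  have g0: "g n \<ge> 0" for n using assms by (simp add: g_def)
  \<comment> \<open>Shifting by \<open>p\<close> turns the sum into one over
    \<open>n < M - p\<close>; restoring the missing nonnegative terms only enlarges it.\<close>
  have shift: "(\<Sum>n<M. if p \<le> n then r ^ p * g (n - p) else 0) \<le> r ^ p * (\<Sum>n<M. g n)"
  proof -
    have "(\<Sum>n<M. if p \<le> n then r ^ p * g (n - p) else 0) = (\<Sum>n\<in>{p..<M}. r ^ p * g (n - p))"
      by (intro sum.mono_neutral_cong_right) auto
    also have "\<dots> = (\<Sum>n<M - p. r ^ p * g n)"
      by (rule sum.reindex_bij_witness[of _ "\<lambda>n. n + p" "\<lambda>n. n - p"]) auto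
    also have "\<dots> \<le> (\<Sum>n<M. r ^ p * g n)"
      using assms g0 by (intro sum_mono2) auto
    finally show ?thesis by (simp add: sum_distrib_left)
  qed
  have "(\<Sum>n<M. g n) = (\<Sum>n<M. card (partitions_in S n) * r ^ n)
           + (\<Sum>n<M. if p \<le> n then r ^ p * g (n - p) else 0)"
    unfolding sum.distrib[symmetric] g_def
    by (intro sum.cong refl card_partitions_in_insert_mult_power p insert.hyps)
  also have "\<dots> \<le> (\<Prod>p\<in>S. 1 / (1 - r ^ p)) + r ^ p * (\<Sum>n<M. g n)"
    using insert shift by (intro add_mono) auto
  finally have "(\<Sum>n<M. g n) * (1 - r ^ p) \<le> (\<Prod>p\<in>S. 1 / (1 - r ^ p))"
    by (simp add: algebra_simps)
  then have "(\<Sum>n<M. g n) \<le> (\<Prod>p\<in>S. 1 / (1 - r ^ p)) / (1 - r ^ p)"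
    using rp by (simp add: pos_le_divide_eq)
  then show ?case using insert.hyps by (simp add: g_def)
qed

text \<open>Each new part \<open>p\<close> contributes one geometric factor: the functional equation
  G = F + z^p G is solved for G, using that z^p is not 1 inside the unit disc.\<close>

lemma sums_card_partitions_in_finite:
  fixes z :: complex
  assumes "finite S" "0 \<notin> S" "norm z < 1"
  shows "(\<lambda>n. of_nat (card (partitions_in S n)) * z ^ n) sums (\<Prod>p\<in>S. 1 / (1 - z ^ p))"
  using assms(1,2)
proof (induction S rule: finite_induct)
  case empty
  have "(\<lambda>n. of_nat (card (partitions_in {} n)) * z ^ n) = (\<lambda>n. if n = 0 then 1 else 0)"
    by (auto simp: partitions_in_empty fun_eq_iff)
  then show ?case using sums_single[of 0 "\<lambda>_. 1 :: complex"] by simp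
next
  case (insert p S)
  define g where "g n = of_nat (card (partitions_in (insert p S) n)) * z ^ n" for n
  have p: "p > 0" using insert.prems by auto
  have zp: "1 - z ^ p \<noteq> 0"
    using assms(3) p power_eq_1_iff[of z p] by auto
  \<comment> \<open>The real bound at radius \<open>norm z\<close> controls all partial sums of the
    norms.\<close>
  have "summable (\<lambda>n. norm (g n))"
    using sum_card_partitions_in_le[of "insert p S" "norm z"] insert assms(3)
    by (intro bounded_imp_summable[where B = "\<Prod>p\<in>insert p S. 1 / (1 - norm z ^ p)"])
       (auto simp: g_def norm_mult norm_power simp del: sum.lessThan_Suc simp flip: lessThan_Suc_atMost)
  then obtain G where G: "g sums G" using summable_norm_cancel summable_sums by blast
  have "(\<lambda>n. if p \<le> n then z ^ p * g (n - p) else 0) sums (z ^ p * G)"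
    using sums_mult[OF G, of "z ^ p"] by (subst sums_iff_shift'[of _ p, symmetric]) simp
  moreover have "(\<lambda>n. of_nat (card (partitions_in S n)) * z ^ n) sums (\<Prod>p\<in>S. 1 / (1 - z ^ p))"
    using insert by auto
  ultimately have "(\<lambda>n. of_nat (card (partitions_in S n)) * z ^ n + (if p \<le> n then z ^ p * g (n - p) else 0))
      sums ((\<Prod>p\<in>S. 1 / (1 - z ^ p)) + z ^ p * G)"
    by (rule sums_add[rotated])
  also have "(\<lambda>n. of_nat (card (partitions_in S n)) * z ^ n + (if p \<le> n then z ^ p * g (n - p) else 0)) = g"
    unfolding g_def by (intro ext card_partitions_in_insert_mult_power[symmetric] p insert.hyps)
  finally have "G = (\<Prod>p\<in>S. 1 / (1 - z ^ p)) + z ^ p * G"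
    using G sums_unique2 by blast
  then have "G * (1 - z ^ p) = (\<Prod>p\<in>S. 1 / (1 - z ^ p))"
    by (simp add: algebra_simps)
  then have "G = (\<Prod>p\<in>S. 1 / (1 - z ^ p)) / (1 - z ^ p)"
    using zp by (simp add: field_simps)
  with G insert.hyps show ?case by (simp add: g_def[abs_def])
qed

section \<open>Convergence and non-vanishing of the infinite q-products\<close>

lemma qpoch_inf_limit: "norm q < 1 \<Longrightarrow> qpoch t q \<longlonglongrightarrow> qpoch_inf t q"
  using convergent_qpoch[of q t] by (simp add: qpoch_inf_def convergent_LIMSEQ_iff)

text \<open>Every factor differs from 1 by a number of norm below 1, hence is nonzero, and an
  absolutely convergent product of nonzero factors has a nonzero limit. This permits taking
  reciprocals in the limit.\<close>

lemma qpoch_inf_nonzero: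
  assumes "norm q < 1" "norm t < 1"
  shows "qpoch_inf t q \<noteq> 0"
proof -
  have "norm (t * q ^ k) < 1" for k
    using assms mult_left_le[of "norm q ^ k" "norm t"]
    by (simp add: norm_mult norm_power power_le_one)
  then have "t * q ^ k \<noteq> 1" for k
    by (metis norm_one order_less_irrefl)
  then have nz: "1 + - (t * q ^ k) \<noteq> 0" for k
    by (metis add_uminus_conv_diff eq_iff_diff_eq_0)
  have "summable (\<lambda>k. norm (- (t * q ^ k)))"
    using assms by (simp add: norm_mult norm_power summable_mult summable_geometric)
  then have "convergent_prod (\<lambda>k. 1 + - (t * q ^ k))"
    by (intro abs_convergent_prod_imp_convergent_prod summable_imp_abs_convergent_prod) simp
  then have "\<exists>L. (\<lambda>n. \<Prod>k\<le>n. 1 + - (t * q ^ k)) \<longlonglongrightarrow> L \<and> L \<noteq> 0"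
    by (simp only: convergent_prod_iff_nz_lim[OF nz])
  then obtain L where L: "(\<lambda>n. \<Prod>k\<le>n. 1 + - (t * q ^ k)) \<longlonglongrightarrow> L" "L \<noteq> 0"
    by blast
  have "(\<lambda>n. qpoch t q (Suc n)) \<longlonglongrightarrow> qpoch_inf t q"
    using qpoch_inf_limit[OF assms(1)] by (rule LIMSEQ_Suc)
  then have "(\<lambda>n. \<Prod>k\<le>n. 1 + - (t * q ^ k)) \<longlonglongrightarrow> qpoch_inf t q"
    by (simp add: qpoch_def lessThan_Suc_atMost)
  with L show ?thesis using LIMSEQ_unique by blast
qed

section \<open>Euler's product for parts congruent to 1 or 5 modulo 6\<close>

definition parts15 :: "nat set" where
  "parts15 = {p. p mod 6 = 1 \<or> p mod 6 = 5}"

text \<open>Truncating at multiples of 6 makes each block add exactly two parts, hence one factor to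
  each of the two q-products with base \<open>z ^ 6\<close>.\<close>

lemma parts15_below_Suc:
  "parts15 \<inter> {..<6 * Suc N} = insert (6 * N + 1) (insert (6 * N + 5) (parts15 \<inter> {..<6 * N}))"
proof -
  have "{..<6 * Suc N} = {..<6 * N} \<union> {6 * N, 6 * N + 1, 6 * N + 2, 6 * N + 3, 6 * N + 4, 6 * N + 5}"
    by auto
  moreover have "6 * N + k \<in> parts15 \<longleftrightarrow> k = 1 \<or> k = 5" if "k < 6" for k
    using that by (simp add: parts15_def)
  from this[of 0] this[of 1] this[of 2] this[of 3] this[of 4] this[of 5]
  have "6 * N \<notin> parts15" "6 * N + 1 \<in> parts15" "6 * N + 2 \<notin> parts15" "6 * N + 3 \<notin> parts15"
    "6 * N + 4 \<notin> parts15" "6 * N + 5 \<in> parts15"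
    by simp_all
  ultimately show ?thesis
    by (simp only: Int_Un_distrib Int_insert_right if_True if_False Int_empty_right) blast
qed

lemma prod_parts15_below:
  "(\<Prod>p\<in>parts15 \<inter> {..<6 * N}. 1 / (1 - z ^ p)) = 1 / (qpoch z (z ^ 6) N * qpoch (z ^ 5) (z ^ 6) N)"
proof (induction N)
  case 0
  then show ?case by (simp add: qpoch_def)
next
  case (Suc N)
  have "(\<Prod>p\<in>parts15 \<inter> {..<6 * Suc N}. 1 / (1 - z ^ p)) =
      1 / (1 - z ^ (6 * N + 1)) * (1 / (1 - z ^ (6 * N + 5)) * (\<Prod>p\<in>parts15 \<inter> {..<6 * N}. 1 / (1 - z ^ p)))"
    unfolding parts15_below_Suc by (subst prod.insert; simp)+
  also have "z ^ (6 * N + 1) = z * (z ^ 6) ^ N" by (simp add: power_mult)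
  also have "z ^ (6 * N + 5) = z ^ 5 * (z ^ 6) ^ N" by (simp add: power_add power_mult)
  finally show ?case by (simp add: Suc qpoch_def)
qed

lemma tendsto_prod_parts15:
  assumes "norm z < 1"
  shows "(\<lambda>N. \<Prod>p\<in>parts15 \<inter> {..<6 * N}. 1 / (1 - z ^ p)) \<longlonglongrightarrow> 1 / qpoch_inf2 z (z ^ 5) (z ^ 6)"
proof -
  have n: "norm (z ^ 5) < 1" "norm (z ^ 6) < 1"
    using assms by (simp_all add: norm_power power_less_one_iff)
  then show ?thesis
    unfolding prod_parts15_below qpoch_inf2_def
    using assms by (intro tendsto_intros qpoch_inf_limit) (auto simp: qpoch_inf_nonzero)
qed

text \<open>A partial sum involves only finitely many parts, so it lies below a finite product;
  these products converge and are therefore bounded uniformly.\<close>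

lemma summable_card_partitions_parts15:
  fixes r :: real
  assumes "0 \<le> r" "r < 1"
  shows "summable (\<lambda>n. card (partitions_in parts15 n) * r ^ n)"
proof -
  let ?S = "\<lambda>N. parts15 \<inter> {..<6 * N}"
  \<comment> \<open>The limit is known for complex arguments, so the bound is found there and
    carried back to the reals.\<close>
  have "Bseq (\<lambda>N. \<Prod>p\<in>?S N. 1 / (1 - complex_of_real r ^ p))"
    using tendsto_prod_parts15[of "of_real r"] assms by (intro convergent_imp_Bseq convergentI) auto
  then obtain B where B: "norm (\<Prod>p\<in>?S N. 1 / (1 - complex_of_real r ^ p)) \<le> B" for N
    by (meson BseqE)
  have B': "(\<Prod>p\<in>?S N. 1 / (1 - r ^ p)) \<le> B" for N
  proof -
    have "(\<Prod>p\<in>?S N. 1 / (1 - complex_of_real r ^ p)) = of_real (\<Prod>p\<in>?S N. 1 / (1 - r ^ p))"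
      by simp
    then show ?thesis using B[of N] by (simp only: norm_of_real)
  qed
  have "(\<Sum>n\<le>M. card (partitions_in parts15 n) * r ^ n) \<le> B" for M
  proof -
    \<comment> \<open>All parts that can occur for \<open>n \<le> M\<close> lie below
      \<open>6 * Suc M\<close>, so truncating there changes no coefficient.\<close>
    have "(\<Sum>n\<le>M. card (partitions_in parts15 n) * r ^ n)
        = (\<Sum>n<Suc M. card (partitions_in (?S (Suc M)) n) * r ^ n)"
      unfolding lessThan_Suc_atMost
      by (intro sum.cong refl arg_cong2[where f = "(*)"] arg_cong[where f = "\<lambda>A. real (card A)"]
           partitions_in_cong) auto
    also have "\<dots> \<le> (\<Prod>p\<in>?S (Suc M). 1 / (1 - r ^ p))"
      using assms by (intro sum_card_partitions_in_le) (auto simp: parts15_def)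
    finally show ?thesis using B'[of "Suc M"] by linarith
  qed
  then show ?thesis
    using assms by (intro bounded_imp_summable[where B = B]) auto
qed

text \<open>Limit of the finite case by Tannery's theorem: as the truncation grows, each coefficient
  becomes constant, and the series for all of \<open>parts15\<close> at \<open>norm z\<close>
  dominates.\<close>

lemma sums_card_partitions_parts15:
  fixes z :: complex
  assumes "norm z < 1"
  shows "(\<lambda>n. of_nat (card (partitions_in parts15 n)) * z ^ n) sums (1 / qpoch_inf2 z (z ^ 5) (z ^ 6))"
proof -
  let ?S = "\<lambda>N. parts15 \<inter> {..<6 * N}"
  let ?h = "\<lambda>n. real (card (partitions_in parts15 n)) * norm z ^ n"
  have sm: "summable ?h" using assms by (intro summable_card_partitions_parts15) auto
  have "((\<lambda>N. \<Sum>n. of_nat (card (partitions_in (?S N) n)) * z ^ n)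
      \<longlongrightarrow> (\<Sum>n. of_nat (card (partitions_in parts15 n)) * z ^ n)) sequentially"
  proof (rule tannerys_theorem[where M = ?h, THEN conjunct2, THEN conjunct2])
    fix n
    have "partitions_in (?S N) n = partitions_in parts15 n" if "N > n" for N
      using that by (intro partitions_in_cong) auto
    then have "\<forall>\<^sub>F N in sequentially. of_nat (card (partitions_in parts15 n)) * z ^ n
        = of_nat (card (partitions_in (?S N) n)) * z ^ n"
      by (auto intro!: eventually_mono[OF eventually_gt_at_top[of n]])
    then show "(\<lambda>N. of_nat (card (partitions_in (?S N) n)) * z ^ n)
        \<longlonglongrightarrow> of_nat (card (partitions_in parts15 n)) * z ^ n"
      by (rule Lim_transform_eventually[OF tendsto_const])
  next
    have "norm (of_nat (card (partitions_in (?S N) n)) * z ^ n) \<le> ?h n" for n N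
      using card_partitions_in_mono[of "?S N" parts15 n]
      by (auto simp: norm_mult norm_power intro!: mult_right_mono)
    \<comment> \<open>The domination holds for all pairs, so the eventuality on the product filter
      is trivial.\<close>
    then have "(\<lambda>(n, N). norm (of_nat (card (partitions_in (?S N) n)) * z ^ n) \<le> ?h n) = (\<lambda>_. True)"
      by (auto simp: fun_eq_iff)
    then show "\<forall>\<^sub>F (n, N) in sequentially \<times>\<^sub>F sequentially.
        norm (of_nat (card (partitions_in (?S N) n)) * z ^ n) \<le> ?h n"
      by (simp only: eventually_True)
  qed (use sm in auto)
  moreover have "(\<Sum>n. of_nat (card (partitions_in (?S N) n)) * z ^ n) = (\<Prod>p\<in>?S N. 1 / (1 - z ^ p))" for N
    using sums_card_partitions_in_finite[of "?S N" z] assms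
    by (auto simp: parts15_def sums_iff)
  ultimately have "(\<Sum>n. of_nat (card (partitions_in parts15 n)) * z ^ n) = 1 / qpoch_inf2 z (z ^ 5) (z ^ 6)"
    using tendsto_prod_parts15[OF assms] LIMSEQ_unique by auto
  moreover have "summable (\<lambda>n. of_nat (card (partitions_in parts15 n)) * z ^ n)"
    by (rule summable_norm_cancel) (use sm in \<open>simp add: norm_mult norm_power\<close>)
  ultimately show ?thesis by (simp add: sums_iff)
qed

section \<open>Reduction of \<open>rho6\<close> to partitions of half the argument\<close>

lemma rho6_odd: "odd n \<Longrightarrow> rho6 n = 0"
proof -
  assume n: "odd n"
  \<comment> \<open>A part \<open>l\<close> together with a remainder of sum \<open>l\<close> gives
    total \<open>2 * l\<close>. The claim covers every \<open>l\<close>, so nothing about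
    \<open>Max\<close> has to be known.\<close>
  have "\<not> (P \<in> partitions_of n \<and> count P l = 1 \<and> P - {#l#} \<in> partitions_of l)" for P l
  proof
    assume *: "P \<in> partitions_of n \<and> count P l = 1 \<and> P - {#l#} \<in> partitions_of l"
    then have "l \<in># P" by (metis count_eq_zero_iff zero_neq_one)
    then obtain R where "P = add_mset l R" by (meson multi_member_split)
    with * have "n = 2 * l" by (auto simp: partitions_of_def)
    with n show False by simp
  qed
  then have "{P \<in> partitions_of n. let l = Max (set_mset P); R = P - {#l#} in
       count P l = 1 \<and> (\<forall>p\<in>#R. p mod 6 = 1 \<or> p mod 6 = 5) \<and> R \<in> partitions_of l} = {}"
    unfolding Let_def by blast
  then show ?thesis by (simp only: rho6_def card.empty)
qed

text \<open>Adding \<open>l\<close> is a bijection from the partitions of \<open>l\<close> into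
  parts from \<open>parts15\<close>, except \<open>{#l#}\<close>, which would make \<open>l\<close>
  occur twice. The natural subtraction does not truncate, since \<open>{#l#}\<close> is among those
  counted when \<open>l\<close> is in \<open>parts15\<close>.\<close>

lemma rho6_double:
  assumes l: "l > 0"
  shows "rho6 (2 * l) = card (partitions_in parts15 l) - (if l \<in> parts15 then 1 else 0)"
proof -
  let ?A = "{P \<in> partitions_of (2 * l). let l = Max (set_mset P); R = P - {#l#} in
       count P l = 1 \<and> (\<forall>p\<in>#R. p mod 6 = 1 \<or> p mod 6 = 5) \<and> R \<in> partitions_of l}"
  have "?A = add_mset l ` (partitions_in parts15 l - {{#l#}})"
  proof (intro equalityI subsetI)
    fix P assume P: "P \<in> ?A"
    define m where "m = Max (set_mset P)"
    from P have *: "P \<in> partitions_of (2 * l)" "count P m = 1" "P - {#m#} \<in> partitions_of m"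
        "set_mset (P - {#m#}) \<subseteq> parts15"
      by (auto simp: Let_def m_def parts15_def)
    then have "m \<in># P" by (metis count_eq_zero_iff zero_neq_one)
    then obtain R where R: "P = add_mset m R" by (meson multi_member_split)
    with * have "m = l" by (auto simp: partitions_of_def)
    with * R show "P \<in> add_mset l ` (partitions_in parts15 l - {{#l#}})"
      by (auto simp: partitions_in_def)
  next
    fix P assume "P \<in> add_mset l ` (partitions_in parts15 l - {{#l#}})"
    then obtain R where R: "P = add_mset l R" "R \<in> partitions_of l" "set_mset R \<subseteq> parts15" "R \<noteq> {#l#}"
      by (auto simp: partitions_in_def)
    \<comment> \<open>If \<open>l\<close> occurred, the rest of \<open>R\<close> would be positive
      parts of sum 0, hence empty, leaving the excluded \<open>{#l#}\<close>.\<close>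
    have "l \<notin># R"
    proof
      assume "l \<in># R"
      then obtain Q where "R = add_mset l Q" by (meson multi_member_split)
      with R show False by (cases Q) (auto simp: partitions_of_def)
    qed
    moreover have "Max (set_mset P) = l"
      using R partitions_of_part_le by (intro Max_eqI) auto
    moreover have "P \<in> partitions_of (2 * l)" using R l by (auto simp: partitions_of_def)
    ultimately show "P \<in> ?A" using R
      by (auto simp: Let_def parts15_def count_eq_zero_iff)
  qed
  then have "rho6 (2 * l) = card (partitions_in parts15 l - {{#l#}})"
    by (simp only: rho6_def) (simp add: card_image inj_on_def)
  moreover have "{#l#} \<in> partitions_in parts15 l \<longleftrightarrow> l \<in> parts15"
    using l by (auto simp: partitions_in_def partitions_of_def)
  ultimately show ?thesis by (simp add: card_Diff_singleton_if)
qed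

section \<open>Power series supported on arithmetic progressions\<close>

text \<open>A geometric series in \<open>q ^ m\<close> spread over the exponents
  \<open>m * k + r\<close>; all other coefficients vanish, so reindexing keeps the sum.\<close>

lemma sums_residue_class:
  fixes q :: complex
  assumes "norm q < 1" "r < m"
  shows "(\<lambda>n. (if n mod m = r then 1 else 0) * q ^ n) sums (q ^ r / (1 - q ^ m))"
proof -
  have "norm (q ^ m) < 1" using assms by (simp add: norm_power power_less_one_iff)
  then have "(\<lambda>k. q ^ r * (q ^ m) ^ k) sums (q ^ r * (1 / (1 - q ^ m)))"
    by (intro sums_mult geometric_sums)
  then have "(\<lambda>k. (if (m * k + r) mod m = r then 1 else 0) * q ^ (m * k + r)) sums (q ^ r / (1 - q ^ m))"
    using assms by (simp add: power_add power_mult) (simp add: mult.commute)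
  moreover have "strict_mono (\<lambda>k. m * k + r)"
    using assms by (auto simp: strict_mono_def)
  moreover have "(if n mod m = r then 1 else 0) * q ^ n = 0" if "n \<notin> range (\<lambda>k. m * k + r)" for n
  proof -
    have "n = m * (n div m) + n mod m" by simp
    with that have "n mod m \<noteq> r" by blast
    then show ?thesis by simp
  qed
  ultimately show ?thesis
    by (subst (asm) sums_mono_reindex) auto
qed

lemma sums_even_powers:
  fixes q s :: complex and a :: "nat \<Rightarrow> complex"
  assumes "(\<lambda>n. a n * (q ^ 2) ^ n) sums s"
  shows "(\<lambda>n. (if even n then a (n div 2) else 0) * q ^ n) sums s"
proof -
  have "(\<lambda>k. (if even (2 * k) then a (2 * k div 2) else 0) * q ^ (2 * k)) sums s"
    using assms by (simp add: power_mult)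
  moreover have "strict_mono (\<lambda>k::nat. 2 * k)" by (auto simp: strict_mono_def)
  moreover have "(if even n then a (n div 2) else 0) * q ^ n = 0" if "n \<notin> range (\<lambda>k. 2 * k)" for n
    using that by (auto elim!: evenE)
  ultimately show ?thesis
    by (subst (asm) sums_mono_reindex) auto
qed

section \<open>Comparison of coefficients\<close>

theorem theorem6:
  "\<exists>A. (\<lambda>q::complex. 1 / qpoch_inf2 (q ^ 2) (q ^ 10) (q ^ 12)
              - (q ^ 2 + q ^ 10) / (1 - q ^ 12)) has_fps_expansion A \<and>
       (\<forall>n\<ge>1. of_nat (rho6 n) = fps_nth A n)"
proof -
  \<comment> \<open>The residues 2 and 10 modulo 12 are the doubles of 1 and 5 modulo 6, so the
    subtracted indicators mark exactly the exceptional \<open>n = 2 * l\<close>.\<close>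
  define c :: "nat \<Rightarrow> complex" where
    "c n = (if even n then of_nat (card (partitions_in parts15 (n div 2))) else 0)
       - ((if n mod 12 = 2 then 1 else 0) + (if n mod 12 = 10 then 1 else 0))" for n
  have "(\<lambda>n. c n * q ^ n) sums
      (1 / qpoch_inf2 (q ^ 2) (q ^ 10) (q ^ 12) - (q ^ 2 + q ^ 10) / (1 - q ^ 12))"
    if q: "norm q < 1" for q
  proof -
    have "norm (q ^ 2) < 1" using q by (simp add: norm_power power_less_one_iff)
    \<comment> \<open>With z = q^2 the arguments z, z^5 and z^6 become q^2, q^10 and q^12.\<close>
    from sums_card_partitions_parts15[OF this]
    have "(\<lambda>n. (if even n then of_nat (card (partitions_in parts15 (n div 2))) else 0) * q ^ n) sums
        (1 / qpoch_inf2 (q ^ 2) (q ^ 10) (q ^ 12))"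
      by (intro sums_even_powers) (simp flip: power_mult)
    from sums_diff[OF this sums_add[OF sums_residue_class[of q 2 12] sums_residue_class[of q 10 12]]]
    show ?thesis using q by (simp add: c_def add_divide_distrib left_diff_distrib distrib_right)
  qed
  then have "(\<lambda>q. 1 / qpoch_inf2 (q ^ 2) (q ^ 10) (q ^ 12) - (q ^ 2 + q ^ 10) / (1 - q ^ 12))
      has_fps_expansion Abs_fps c"
    by (intro has_fps_expansionI eventually_nhds_in_open[of "ball 0 1", THEN eventually_mono]) auto
  moreover have "of_nat (rho6 n) = c n" if n: "n \<ge> 1" for n
  proof (cases "even n")
    case True
    then obtain l where l: "n = 2 * l" by (elim evenE)
    with n have "l > 0" by auto
    \<comment> \<open>Needed to turn the natural subtraction in \<open>rho6_double\<close> into a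
      complex one.\<close>
    moreover have "card (partitions_in parts15 l) \<ge> 1" if "l \<in> parts15"
    proof -
      have "{#l#} \<in> partitions_in parts15 l"
        using that \<open>l > 0\<close> by (auto simp: partitions_in_def partitions_of_def)
      then show ?thesis using finite_partitions_in by (metis One_nat_def Suc_leI card_gt_0_iff empty_iff)
    qed
    moreover have "(2 * l) mod 12 = 2 * (l mod 6)"
      using mult_mod_right[of 2 l 6] by simp
    ultimately show ?thesis
      by (auto simp: l c_def rho6_double parts15_def of_nat_diff)
  next
    case False
    \<comment> \<open>An odd \<open>n\<close> has odd residue modulo 12, so both sides are
      zero.\<close>
    then have "n mod 12 \<noteq> 2" "n mod 12 \<noteq> 10" by presburger+
    with False show ?thesis by (simp add: rho6_odd c_def)
  qed
  ultimately show ?thesis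
    by (intro exI[of _ "Abs_fps c"]) simp
qed

end
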